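(* Let $V$ be a finite set, let $k \geq 2$, and let $A_1, \ldots, A_k \subseteq V$ be pairwise disjoint. For a strictly positive distribution $p_V$ of the binary vector $X_V$, consider the $k$-tuple of (strictly positive) conditional distributions $$c(p_V) = \bigl(p(x_{A_1} \mid x_{A_k}),\ p(x_{A_2} \mid x_{A_1}),\ \ldots,\ p(x_{A_k} \mid x_{A_{k-1}})\bigr),$$ regarded as a tuple of real arrays. Then the marginal distributions $p(x_{A_i})$, $i=1,\ldots,k$, are smoothly recoverable from $c(p_V)$: for each $i$ there are an open subset $U$ of the Euclidean space of such tuples of real arrays containing $c(p_V)$ for every strictly positive $p_V$, and a smooth map $F_i : U \to \mathbb{R}^{\{0,1\}^{A_i}}$, such that $p_{A_i} = F_i(c(p_V))$ for every strictly positive $p_V$.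
   Context: $X_V = (X_v)_{v\in V}$ is a vector of binary random variables, $X_v\in\{0,1\}$, with strictly positive joint distribution $p_V(x_V) = P(X_V = x_V) > 0$. For $A \subseteq V$, $p_A(x_A) = p(x_A) = P(X_A = x_A)$ is the marginal distribution of $X_A = (X_v)_{v \in A}$; for disjoint $A,B \subseteq V$, $p(x_A \mid x_B) = P(X_A = x_A \mid X_B = x_B)$. *)

theory Defs
  imports "HOL-Probability.Probability"
begin

section \<open>Binary random vectors\<close>

text \<open>\<open>configs A\<close> is \<open>{0,1}\<^sup>A\<close>. A distribution \<open>p\<^sub>V\<close> is a pmf on functions that are
  extensional on \<open>V\<close>, and \<open>X\<^sub>A\<close> is the map \<open>\<lambda>x. restrict x A\<close>.\<close>

definition configs :: "'v set \<Rightarrow> ('v \<Rightarrow> nat) set" where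
  "configs A = (A \<rightarrow>\<^sub>E {0, 1})"

definition strictly_positive :: "'v set \<Rightarrow> ('v \<Rightarrow> nat) pmf \<Rightarrow> bool" where
  "strictly_positive V p \<longleftrightarrow> set_pmf p = configs V"

definition marginal :: "('v \<Rightarrow> nat) pmf \<Rightarrow> 'v set \<Rightarrow> ('v \<Rightarrow> nat) \<Rightarrow> real" where
  "marginal p A = (\<lambda>a\<in>configs A. \<P>(x in measure_pmf p. restrict x A = a))"

definition conditional ::
  "('v \<Rightarrow> nat) pmf \<Rightarrow> 'v set \<Rightarrow> 'v set \<Rightarrow> ('v \<Rightarrow> nat) \<Rightarrow> ('v \<Rightarrow> nat) \<Rightarrow> real" where
  "conditional p A B a b = \<P>(x in measure_pmf p. restrict x A = a \<bar> restrict x B = b)"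

section \<open>The cyclic tuple of conditional distributions\<close>

definition cyc_pred :: "nat \<Rightarrow> nat \<Rightarrow> nat" where
  "cyc_pred k i = (if i = 1 then k else i - 1)"

text \<open>The tuple of arrays \<open>c(p\<^sub>V)\<close> is a single point of \<open>\<real>\<^sup>I\<close>, where the coordinate
  \<open>(i, a, b) \<in> I\<close> is the entry of the \<open>i\<close>-th array at \<open>a \<in> {0,1}\<^bsup>A i\<^esup>\<close> and
  \<open>b \<in> {0,1}\<^bsup>A (i - 1)\<^esup>\<close>, with \<open>A 0\<close> read as \<open>A k\<close>.\<close>

definition cyc_index ::
  "nat \<Rightarrow> (nat \<Rightarrow> 'v set) \<Rightarrow> (nat \<times> ('v \<Rightarrow> nat) \<times> ('v \<Rightarrow> nat)) set" where
  "cyc_index k A = (SIGMA i:{1..k}. configs (A i) \<times> configs (A (cyc_pred k i)))"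

definition cyc_conditionals ::
  "nat \<Rightarrow> (nat \<Rightarrow> 'v set) \<Rightarrow> ('v \<Rightarrow> nat) pmf
    \<Rightarrow> (nat \<times> ('v \<Rightarrow> nat) \<times> ('v \<Rightarrow> nat)) \<Rightarrow> real" where
  "cyc_conditionals k A p =
     (\<lambda>(i, a, b)\<in>cyc_index k A. conditional p (A i) (A (cyc_pred k i)) a b)"

section \<open>Smooth maps between Euclidean spaces of real arrays\<close>

text \<open>For a finite set \<open>I\<close>, the Euclidean space \<open>\<real>\<^sup>I\<close> is \<open>powertop_real I\<close>: the functions
  extensional on \<open>I\<close> with the product topology. \<open>Ck_on n I U f\<close> says that all partial
  derivatives of \<open>f\<close> of order at most \<open>n\<close> exist and are continuous on \<open>U\<close>; it is
  meant for \<open>U\<close> open in \<open>\<real>\<^sup>I\<close>.\<close>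

primrec Ck_on ::
  "nat \<Rightarrow> 'i set \<Rightarrow> ('i \<Rightarrow> real) set \<Rightarrow> (('i \<Rightarrow> real) \<Rightarrow> real) \<Rightarrow> bool" where
  "Ck_on 0 I U f \<longleftrightarrow>
     continuous_map (subtopology (powertop_real I) U) euclideanreal f"
| "Ck_on (Suc n) I U f \<longleftrightarrow>
     continuous_map (subtopology (powertop_real I) U) euclideanreal f \<and>
     (\<forall>i\<in>I. \<exists>g. (\<forall>x\<in>U. ((\<lambda>t. f (x(i := t))) has_real_derivative g x) (at (x i))) \<and>
                Ck_on n I U g)"

definition smooth_map_on ::
  "'i set \<Rightarrow> 'j set \<Rightarrow> ('i \<Rightarrow> real) set \<Rightarrow> (('i \<Rightarrow> real) \<Rightarrow> ('j \<Rightarrow> real)) \<Rightarrow> bool" where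
  "smooth_map_on I J U F \<longleftrightarrow>
     F \<in> U \<rightarrow> topspace (powertop_real J) \<and>
     (\<forall>j\<in>J. \<forall>n. Ck_on n I U (\<lambda>x. F x j))"

end

theory Submission
  imports Defs
begin

text \<open>The marginal of \<open>X\<^bsub>A i\<^esub>\<close> is stationary for the Markov kernel obtained by composing the
  conditionals once around the cycle, and all entries of that kernel are positive. Its stationary
  vector is computed by eliminating the states one at a time. Writing the holding rate of the
  eliminated state as the sum of its outgoing rates makes this elimination subtraction-free, so
  the result is a rational function without poles on the whole positive orthant, which serves
  as \<open>U\<close>.\<close>

section \<open>Smooth real functions\<close>

text \<open>The recursive clause speaks of order \<open>n\<close> only for the derivatives, so
  lowering the order for \<open>f\<close> itself takes an induction. The product and inverse rules
  need it, since their derivatives contain undifferentiated factors.\<close>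

lemma Ck_on_SucD: "Ck_on (Suc n) I U f \<Longrightarrow> Ck_on n I U f"
proof (induction n arbitrary: f)
  case 0
  then show ?case by simp
next
  case (Suc n)
  show ?case
    unfolding Ck_on.simps(2)[of n]
  proof (intro conjI ballI)
    show "continuous_map (subtopology (powertop_real I) U) euclideanreal f"
      using Suc.prems by simp
  next
    fix i assume "i \<in> I"
    then obtain g where
      "\<forall>x\<in>U. ((\<lambda>t. f (x(i := t))) has_real_derivative g x) (at (x i))" "Ck_on (Suc n) I U g"
      using Suc.prems unfolding Ck_on.simps(2)[of "Suc n"] by blast
    then show "\<exists>g. (\<forall>x\<in>U. ((\<lambda>t. f (x(i := t))) has_real_derivative g x) (at (x i))) \<and>
        Ck_on n I U g"
      using Suc.IH by blast
  qed
qed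

lemma Ck_on_const: "Ck_on n I U (\<lambda>x. c)"
  by (induction n arbitrary: c) (auto intro!: exI[of _ "\<lambda>x. 0"])

lemma Ck_on_component:
  assumes "c \<in> I"
  shows "Ck_on n I U (\<lambda>x. x c)"
proof -
  have cont: "continuous_map (subtopology (powertop_real I) U) euclideanreal (\<lambda>x. x c)"
    using assms by (intro continuous_map_from_subtopology continuous_map_product_projection)
  show ?thesis
  proof (cases n)
    case 0
    then show ?thesis using cont by simp
  next
    case (Suc m)
    have "\<exists>g. (\<forall>x\<in>U. ((\<lambda>t. (x(i := t)) c) has_real_derivative g x) (at (x i))) \<and> Ck_on m I U g"
      for i
      by (rule exI[of _ "\<lambda>x. if i = c then 1 else 0"]) (auto simp: Ck_on_const)
    then show ?thesis using cont Suc by simp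
  qed
qed

lemma Ck_on_add:
  assumes "Ck_on n I U f" "Ck_on n I U g"
  shows "Ck_on n I U (\<lambda>x. f x + g x)"
  using assms
proof (induction n arbitrary: f g)
  case 0
  then show ?case by (auto intro: continuous_map_add)
next
  case (Suc n)
  show ?case
    unfolding Ck_on.simps(2)
  proof (intro conjI ballI)
    show "continuous_map (subtopology (powertop_real I) U) euclideanreal (\<lambda>x. f x + g x)"
      using Suc.prems by (auto intro: continuous_map_add)
  next
    fix i assume "i \<in> I"
    then obtain f' g' where
      "\<forall>x\<in>U. ((\<lambda>t. f (x(i := t))) has_real_derivative f' x) (at (x i))" "Ck_on n I U f'"
      "\<forall>x\<in>U. ((\<lambda>t. g (x(i := t))) has_real_derivative g' x) (at (x i))" "Ck_on n I U g'"
      using Suc.prems unfolding Ck_on.simps(2) by metis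
    then show "\<exists>h. (\<forall>x\<in>U. ((\<lambda>t. f (x(i := t)) + g (x(i := t))) has_real_derivative h x)
        (at (x i))) \<and> Ck_on n I U h"
      by (intro exI[of _ "\<lambda>x. f' x + g' x"]) (auto intro: Suc.IH DERIV_add)
  qed
qed

lemma Ck_on_mult:
  assumes "Ck_on n I U f" "Ck_on n I U g"
  shows "Ck_on n I U (\<lambda>x. f x * g x)"
  using assms
proof (induction n arbitrary: f g)
  case 0
  then show ?case by (auto intro: continuous_map_real_mult)
next
  case (Suc n)
  show ?case
    unfolding Ck_on.simps(2)
  proof (intro conjI ballI)
    show "continuous_map (subtopology (powertop_real I) U) euclideanreal (\<lambda>x. f x * g x)"
      using Suc.prems by (auto intro: continuous_map_real_mult)
  next
    fix i assume "i \<in> I"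
    then obtain f' g' where D:
      "\<forall>x\<in>U. ((\<lambda>t. f (x(i := t))) has_real_derivative f' x) (at (x i))" "Ck_on n I U f'"
      "\<forall>x\<in>U. ((\<lambda>t. g (x(i := t))) has_real_derivative g' x) (at (x i))" "Ck_on n I U g'"
      using Suc.prems unfolding Ck_on.simps(2) by metis
    \<comment> \<open>Each summand pairs a derivative, known at order \<open>n\<close>, with an
      original factor, known at order \<open>Suc n\<close> and lowered. The induction hypothesis is
      applied to these new pairs, hence \<open>arbitrary: f g\<close>.\<close>
    let ?h = "\<lambda>x. f' x * g x + g' x * f x"
    have "((\<lambda>t. f (x(i := t)) * g (x(i := t))) has_real_derivative ?h x) (at (x i))"
      if "x \<in> U" for x
      using DERIV_mult[OF bspec[OF D(1) that] bspec[OF D(3) that]] by simp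
    moreover have "Ck_on n I U ?h"
      using D Suc.prems[THEN Ck_on_SucD] by (intro Ck_on_add Suc.IH)
    ultimately show "\<exists>h. (\<forall>x\<in>U. ((\<lambda>t. f (x(i := t)) * g (x(i := t))) has_real_derivative h x)
        (at (x i))) \<and> Ck_on n I U h"
      by (intro exI[of _ ?h] conjI ballI)
  qed
qed

lemma Ck_on_inverse:
  assumes "Ck_on n I U f" "\<And>x. x \<in> U \<Longrightarrow> f x \<noteq> 0"
  shows "Ck_on n I U (\<lambda>x. inverse (f x))"
  using assms(1)
proof (induction n)
  case 0
  then show ?case using assms(2) by (auto intro!: continuous_map_real_inverse)
next
  case (Suc n)
  show ?case
    unfolding Ck_on.simps(2)
  proof (intro conjI ballI)
    show "continuous_map (subtopology (powertop_real I) U) euclideanreal (\<lambda>x. inverse (f x))"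
      using Suc.prems assms(2) by (auto intro!: continuous_map_real_inverse)
  next
    fix i assume "i \<in> I"
    then obtain f' where D:
      "\<forall>x\<in>U. ((\<lambda>t. f (x(i := t))) has_real_derivative f' x) (at (x i))" "Ck_on n I U f'"
      using Suc.prems unfolding Ck_on.simps(2) by metis
    \<comment> \<open>The derivative is a product of \<open>f'\<close>, a constant and the same
      reciprocal, so the induction hypothesis for this one \<open>f\<close> suffices.\<close>
    let ?h = "\<lambda>x. (- 1) * (inverse (f x) * f' x * inverse (f x))"
    have "((\<lambda>t. inverse (f (x(i := t)))) has_real_derivative ?h x) (at (x i))" if "x \<in> U" for x
      using DERIV_inverse'[OF bspec[OF D(1) that]] assms(2)[OF that] by simp
    moreover have "Ck_on n I U ?h"
      using D Suc.IH Suc.prems[THEN Ck_on_SucD] by (intro Ck_on_mult Ck_on_const) auto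
    ultimately show "\<exists>h. (\<forall>x\<in>U. ((\<lambda>t. inverse (f (x(i := t)))) has_real_derivative h x)
        (at (x i))) \<and> Ck_on n I U h"
      by (intro exI[of _ ?h] conjI ballI)
  qed
qed

section \<open>Positive smooth functions and subtraction-free arithmetic\<close>

text \<open>Positivity is bundled with smoothness because it keeps every denominator away from zero:
  the class is closed under sums, products and quotients, but not under differences.\<close>

definition smooth_pos :: "'i set \<Rightarrow> ('i \<Rightarrow> real) set \<Rightarrow> (('i \<Rightarrow> real) \<Rightarrow> real) \<Rightarrow> bool" where
  "smooth_pos I U f \<longleftrightarrow> (\<forall>x\<in>U. 0 < f x) \<and> (\<forall>n. Ck_on n I U f)"

lemma smooth_pos_pos: "smooth_pos I U f \<Longrightarrow> x \<in> U \<Longrightarrow> 0 < f x"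
  by (simp add: smooth_pos_def)

lemma smooth_pos_one: "smooth_pos I U (\<lambda>x. 1)"
  by (simp add: smooth_pos_def Ck_on_const)

lemma smooth_pos_add:
  "smooth_pos I U f \<Longrightarrow> smooth_pos I U g \<Longrightarrow> smooth_pos I U (\<lambda>x. f x + g x)"
  by (simp add: smooth_pos_def Ck_on_add add_pos_pos)

lemma smooth_pos_mult:
  "smooth_pos I U f \<Longrightarrow> smooth_pos I U g \<Longrightarrow> smooth_pos I U (\<lambda>x. f x * g x)"
  by (simp add: smooth_pos_def Ck_on_mult)

lemma smooth_pos_divide:
  assumes "smooth_pos I U f" "smooth_pos I U g"
  shows "smooth_pos I U (\<lambda>x. f x / g x)"
  unfolding divide_inverse
  using assms by (auto simp: smooth_pos_def intro!: Ck_on_mult Ck_on_inverse)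

text \<open>An empty sum is 0 and not positive, which is why non-empty state spaces are carried
  along below.\<close>

lemma smooth_pos_sum:
  assumes "finite S" "S \<noteq> {}" "\<And>s. s \<in> S \<Longrightarrow> smooth_pos I U (f s)"
  shows "smooth_pos I U (\<lambda>x. \<Sum>s\<in>S. f s x)"
  using assms by (induction S rule: finite_ne_induct) (auto intro: smooth_pos_add)

lemma smooth_map_on_restrict:
  assumes "\<forall>a\<in>J. smooth_pos I U (w a)"
  shows "smooth_map_on I J U (\<lambda>x. \<lambda>a\<in>J. w a x)"
  using assms by (auto simp: smooth_map_on_def smooth_pos_def)

text \<open>A product of proper open subsets is open in the product topology because only finitely
  many coordinates are constrained.\<close>

lemma openin_positive_orthant:
  assumes "finite I"
  shows "openin (powertop_real I) (\<Pi>\<^sub>E c\<in>I. {0<..})"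
  using assms by (subst openin_PiE) auto

section \<open>Stationary vectors of positive kernels\<close>

text \<open>State reduction, as in the Grassmann-Taksar-Heyman algorithm. The equation at
  \<open>b\<close> says outflow equals inflow; the self-loop \<open>Q b b x\<close> cancels, so
  solving for one state divides by its other outgoing rates only. The conclusion is proportionality
  of \<open>m\<close> to \<open>w\<close> in cross-multiplied form, with \<open>w\<close> chosen
  independently of \<open>x\<close> and \<open>m\<close>.\<close>

lemma smooth_stationary_ray:
  assumes "finite S" "S \<noteq> {}"
    and "\<forall>a\<in>S. \<forall>b\<in>S. smooth_pos I U (Q a b)"
  shows "\<exists>w. (\<forall>a\<in>S. smooth_pos I U (w a)) \<and>
    (\<forall>x\<in>U. \<forall>m. (\<forall>b\<in>S. m b * (\<Sum>a\<in>S. Q b a x) = (\<Sum>a\<in>S. m a * Q a b x)) \<longrightarrow>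
      (\<forall>a\<in>S. \<forall>b\<in>S. m a * w b x = m b * w a x))"
  using assms
proof (induction S arbitrary: Q rule: finite_ne_induct)
  case (singleton s)
  show ?case
    by (rule exI[of _ "\<lambda>a x. 1"]) (auto intro: smooth_pos_one)
next
  case (insert s S)
  have sm: "smooth_pos I U (Q a b)" if "a \<in> insert s S" "b \<in> insert s S" for a b
    using insert.prems that by blast
  \<comment> \<open>Total rate of leaving \<open>s\<close>, self-loop excluded. When the row of
    \<open>s\<close> sums to 1 this is \<open>1 - Q s s x\<close>, written without
    subtraction.\<close>
  define D where "D x = (\<Sum>b\<in>S. Q s b x)" for x
  \<comment> \<open>the rates of the chain watched only while it is outside \<open>s\<close>\<close>
  define R where "R a b x = Q a b x + Q a s x * Q s b x / D x" for a b x
  have smD: "smooth_pos I U D"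
    unfolding D_def by (intro smooth_pos_sum insert.hyps sm) auto
  have smR: "smooth_pos I U (R a b)" if "a \<in> S" "b \<in> S" for a b
    unfolding R_def using that
    by (intro smooth_pos_add smooth_pos_mult smooth_pos_divide smD sm) auto
  obtain w where w: "\<forall>a\<in>S. smooth_pos I U (w a)"
    and ray: "\<forall>x\<in>U. \<forall>m. (\<forall>b\<in>S. m b * (\<Sum>a\<in>S. R b a x) = (\<Sum>a\<in>S. m a * R a b x)) \<longrightarrow>
      (\<forall>a\<in>S. \<forall>b\<in>S. m a * w b x = m b * w a x)"
    using insert.IH[of R] smR by auto
  \<comment> \<open>The weight of \<open>s\<close> is the one forced by the balance equation at
    \<open>s\<close> once the other weights are \<open>w\<close>.\<close>
  define v where "v = w(s := \<lambda>x. (\<Sum>a\<in>S. w a x * Q a s x) / D x)"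
  have v: "v c = w c" if "c \<in> S" for c
    using that insert.hyps by (auto simp: v_def)
  have v_s: "v s x = (\<Sum>a\<in>S. w a x * Q a s x) / D x" for x
    by (simp add: v_def)
  have "smooth_pos I U (v s)"
    unfolding v_s[abs_def] using w sm insert.hyps
    by (intro smooth_pos_divide smooth_pos_sum smooth_pos_mult smD) auto
  then have smv: "\<forall>a\<in>insert s S. smooth_pos I U (v a)"
    using w v by simp
  have "m a * v b x = m b * v a x"
    if x: "x \<in> U" and ab: "a \<in> insert s S" "b \<in> insert s S"
      and bal: "\<forall>b\<in>insert s S.
        m b * (\<Sum>a\<in>insert s S. Q b a x) = (\<Sum>a\<in>insert s S. m a * Q a b x)"
    for x m a b
  proof -
    have D: "D x > 0" using smooth_pos_pos[OF smD x] .
    \<comment> \<open>Balance at \<open>s\<close>, with \<open>m s * Q s s x\<close> cancelled on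
      both sides.\<close>
    have ms: "m s = (\<Sum>a\<in>S. m a * Q a s x) / D x"
      using bal insert.hyps D by (simp add: D_def field_simps)
    \<comment> \<open>Flow from \<open>b\<close> into \<open>s\<close> is redistributed over
      \<open>S\<close> with weights \<open>Q s a x / D x\<close>, which sum to 1, so no outflow is
      lost. Dually, \<open>R_in\<close> recognises the inflow through \<open>s\<close> as
      \<open>m s * Q s b x\<close>. Hence balance for \<open>Q\<close> at \<open>b\<close> is
      balance for \<open>R\<close> at \<open>b\<close>.\<close>
    have R_out: "(\<Sum>a\<in>S. R b a x) = (\<Sum>a\<in>S. Q b a x) + Q b s x" for b
    proof -
      have "(\<Sum>a\<in>S. Q b s x * Q s a x / D x) = Q b s x * D x / D x"
        by (simp only: D_def sum_distrib_left sum_divide_distrib)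
      then show ?thesis using D by (simp add: R_def sum.distrib)
    qed
    have R_in: "(\<Sum>a\<in>S. m a * R a b x) = (\<Sum>a\<in>S. m a * Q a b x) + m s * Q s b x" for b
      by (simp add: R_def ms sum.distrib distrib_left sum_distrib_right sum_divide_distrib
          mult.assoc)
    have "m b * (\<Sum>a\<in>S. R b a x) = (\<Sum>a\<in>S. m a * R a b x)" if "b \<in> S" for b
      using bspec[OF bal, of b] that insert.hyps unfolding R_out R_in
      by (simp add: algebra_simps)
    then have S: "m a * w b x = m b * w a x" if "a \<in> S" "b \<in> S" for a b
      using ray x that by blast
    \<comment> \<open>Proportionality passes to \<open>s\<close> since \<open>m s\<close> and
      \<open>v s x\<close> are the same linear expression in \<open>m\<close> and in
      \<open>w\<close>.\<close>
    have s: "m s * v b x = m b * v s x" if "b \<in> S" for b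
    proof -
      have "(\<Sum>a\<in>S. m a * Q a s x) * w b x = (\<Sum>a\<in>S. (m a * w b x) * Q a s x)"
        unfolding sum_distrib_right by (simp add: mult_ac)
      also have "\<dots> = (\<Sum>a\<in>S. (m b * w a x) * Q a s x)"
        using S that by (intro sum.cong) auto
      also have "\<dots> = m b * (\<Sum>a\<in>S. w a x * Q a s x)"
        by (simp add: sum_distrib_left mult.assoc)
      finally show ?thesis
        unfolding v_s ms v[OF that] by simp
    qed
    have "m a * v b x = m b * v a x" if "a \<in> S" "b \<in> S" for a b
      using S[OF that] v that by simp
    then show ?thesis
      using ab by (auto intro: s s[symmetric])
  qed
  then show ?case
    by (intro exI[of _ v] conjI smv ballI allI impI)
qed

text \<open>When rows sum to 1, stationarity is the balance equation. Total mass 1 then picks one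
  point of the ray, namely \<open>w\<close> divided by its total, which is again
  subtraction-free.\<close>

lemma smooth_stationary:
  assumes "finite S" "S \<noteq> {}"
    and "\<forall>a\<in>S. \<forall>b\<in>S. smooth_pos I U (Q a b)"
  shows "\<exists>w. (\<forall>a\<in>S. smooth_pos I U (w a)) \<and>
    (\<forall>x\<in>U. \<forall>m. (\<forall>b\<in>S. (\<Sum>a\<in>S. Q b a x) = 1) \<longrightarrow>
      (\<forall>b\<in>S. m b = (\<Sum>a\<in>S. m a * Q a b x)) \<longrightarrow> (\<Sum>a\<in>S. m a) = 1 \<longrightarrow>
      (\<forall>a\<in>S. m a = w a x))"
proof -
  obtain w where w: "\<forall>a\<in>S. smooth_pos I U (w a)"
    and ray: "\<forall>x\<in>U. \<forall>m. (\<forall>b\<in>S. m b * (\<Sum>a\<in>S. Q b a x) = (\<Sum>a\<in>S. m a * Q a b x)) \<longrightarrow>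
      (\<forall>a\<in>S. \<forall>b\<in>S. m a * w b x = m b * w a x)"
    using smooth_stationary_ray[OF assms] by blast
  have smW: "smooth_pos I U (\<lambda>x. \<Sum>b\<in>S. w b x)"
    using w by (intro smooth_pos_sum assms) auto
  have sm: "\<forall>a\<in>S. smooth_pos I U (\<lambda>x. w a x / (\<Sum>b\<in>S. w b x))"
    using w smW by (auto intro: smooth_pos_divide)
  have "m a = w a x / (\<Sum>b\<in>S. w b x)"
    if x: "x \<in> U" and a: "a \<in> S" and Q: "\<forall>b\<in>S. (\<Sum>a\<in>S. Q b a x) = 1"
      and m: "\<forall>b\<in>S. m b = (\<Sum>a\<in>S. m a * Q a b x)" "(\<Sum>a\<in>S. m a) = 1" for x m a
  proof -
    have "\<forall>b\<in>S. m b * (\<Sum>a\<in>S. Q b a x) = (\<Sum>a\<in>S. m a * Q a b x)"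
      using m(1) Q by simp
    then have *: "m a * w b x = m b * w a x" if "b \<in> S" for b
      using ray x a that by blast
    have "m a * (\<Sum>b\<in>S. w b x) = (\<Sum>b\<in>S. m b * w a x)"
      unfolding sum_distrib_left by (intro sum.cong * refl)
    also have "\<dots> = w a x"
      using m(2) by (simp flip: sum_distrib_right)
    finally show ?thesis
      using smooth_pos_pos[OF smW x] by (simp add: field_simps)
  qed
  then show ?thesis
    by (intro exI[of _ "\<lambda>a x. w a x / (\<Sum>b\<in>S. w b x)"] conjI sm ballI allI impI)
qed

section \<open>Positive kernels that depend smoothly on the tuple\<close>

text \<open>One \<open>Q\<close>, a function of the point of \<open>U\<close>, serves all
  \<open>p\<close> in \<open>P\<close>; this uniformity yields a recovery map independent of
  \<open>p\<close>. Positivity is asked on all of \<open>U\<close>, but unit row sums only at the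
  points \<open>c p\<close>, since a general point of the orthant is no tuple of
  conditionals.\<close>

definition kernel_between ::
  "'i set \<Rightarrow> ('i \<Rightarrow> real) set \<Rightarrow> 'p set \<Rightarrow> ('p \<Rightarrow> 'i \<Rightarrow> real)
    \<Rightarrow> 's set \<Rightarrow> ('p \<Rightarrow> 's \<Rightarrow> real) \<Rightarrow> 's set \<Rightarrow> ('p \<Rightarrow> 's \<Rightarrow> real) \<Rightarrow> bool" where
  "kernel_between I U P c S m T m' \<longleftrightarrow>
    (\<exists>Q. (\<forall>a\<in>S. \<forall>b\<in>T. smooth_pos I U (Q a b)) \<and>
         (\<forall>p\<in>P. (\<forall>a\<in>S. (\<Sum>b\<in>T. Q a b (c p)) = 1) \<and>
                 (\<forall>b\<in>T. m' p b = (\<Sum>a\<in>S. m p a * Q a b (c p)))))"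

text \<open>Matrix product of the two kernels. Its entries are non-empty sums of products of
  positive functions, hence again positive and smooth.\<close>

lemma kernel_between_trans:
  assumes "kernel_between I U P c S m T m'" "kernel_between I U P c T m' W m''"
    and "finite T" "T \<noteq> {}"
  shows "kernel_between I U P c S m W m''"
proof -
  obtain Q where Q: "\<And>a b. a \<in> S \<Longrightarrow> b \<in> T \<Longrightarrow> smooth_pos I U (Q a b)"
      "\<And>p a. p \<in> P \<Longrightarrow> a \<in> S \<Longrightarrow> (\<Sum>b\<in>T. Q a b (c p)) = 1"
      "\<And>p b. p \<in> P \<Longrightarrow> b \<in> T \<Longrightarrow> m' p b = (\<Sum>a\<in>S. m p a * Q a b (c p))"
    using assms(1) unfolding kernel_between_def by blast
  obtain R where R: "\<And>a b. a \<in> T \<Longrightarrow> b \<in> W \<Longrightarrow> smooth_pos I U (R a b)"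
      "\<And>p a. p \<in> P \<Longrightarrow> a \<in> T \<Longrightarrow> (\<Sum>b\<in>W. R a b (c p)) = 1"
      "\<And>p b. p \<in> P \<Longrightarrow> b \<in> W \<Longrightarrow> m'' p b = (\<Sum>a\<in>T. m' p a * R a b (c p))"
    using assms(2) unfolding kernel_between_def by blast
  let ?Q = "\<lambda>a d x. \<Sum>b\<in>T. Q a b x * R b d x"
  have "smooth_pos I U (?Q a d)" if "a \<in> S" "d \<in> W" for a d
    using that by (intro smooth_pos_sum smooth_pos_mult Q R assms)
  moreover have "(\<Sum>d\<in>W. ?Q a d (c p)) = 1" if "p \<in> P" "a \<in> S" for p a
  proof -
    have "(\<Sum>d\<in>W. ?Q a d (c p)) = (\<Sum>b\<in>T. Q a b (c p) * (\<Sum>d\<in>W. R b d (c p)))"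
      by (subst sum.swap) (simp add: sum_distrib_left)
    then show ?thesis using that Q(2) R(2) by simp
  qed
  moreover have "m'' p d = (\<Sum>a\<in>S. m p a * ?Q a d (c p))" if "p \<in> P" "d \<in> W" for p d
  proof -
    have "m'' p d = (\<Sum>b\<in>T. (\<Sum>a\<in>S. m p a * Q a b (c p)) * R b d (c p))"
      using that R(3) Q(3) by simp
    also have "\<dots> = (\<Sum>a\<in>S. m p a * ?Q a d (c p))"
      unfolding sum_distrib_left sum_distrib_right by (subst sum.swap) (simp add: mult.assoc)
    finally show ?thesis .
  qed
  ultimately show ?thesis
    unfolding kernel_between_def by (intro exI[of _ ?Q] conjI ballI)
qed

text \<open>A kernel from \<open>m\<close> back to \<open>m\<close> makes \<open>m p\<close> a
  stationary vector at \<open>c p\<close>, so the point \<open>c p\<close> determines it through a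
  fixed smooth formula.\<close>

lemma kernel_between_self:
  assumes "kernel_between I U P c S m S m" "finite S" "S \<noteq> {}"
    and "\<forall>p\<in>P. c p \<in> U" "\<forall>p\<in>P. (\<Sum>a\<in>S. m p a) = 1"
  shows "\<exists>w. (\<forall>a\<in>S. smooth_pos I U (w a)) \<and> (\<forall>p\<in>P. \<forall>a\<in>S. m p a = w a (c p))"
proof -
  obtain Q where smQ: "\<forall>a\<in>S. \<forall>b\<in>S. smooth_pos I U (Q a b)"
    and Q: "\<forall>p\<in>P. (\<forall>a\<in>S. (\<Sum>b\<in>S. Q a b (c p)) = 1) \<and>
      (\<forall>b\<in>S. m p b = (\<Sum>a\<in>S. m p a * Q a b (c p)))"
    using assms(1) unfolding kernel_between_def by blast
  obtain w where w: "\<forall>a\<in>S. smooth_pos I U (w a)"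
    and stat: "\<forall>x\<in>U. \<forall>m. (\<forall>b\<in>S. (\<Sum>a\<in>S. Q b a x) = 1) \<longrightarrow>
      (\<forall>b\<in>S. m b = (\<Sum>a\<in>S. m a * Q a b x)) \<longrightarrow> (\<Sum>a\<in>S. m a) = 1 \<longrightarrow>
      (\<forall>a\<in>S. m a = w a x)"
    using smooth_stationary[OF assms(2,3) smQ] by blast
  have "\<forall>a\<in>S. m p a = w a (c p)" if p: "p \<in> P" for p
    using bspec[OF stat bspec[OF assms(4) p], THEN spec[of _ "m p"], THEN mp, THEN mp, THEN mp,
        OF conjunct1[OF bspec[OF Q p]] conjunct2[OF bspec[OF Q p]] bspec[OF assms(5) p]] .
  then show ?thesis
    by (intro exI[of _ w] conjI w ballI) simp
qed

section \<open>Marginals and conditionals\<close>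

lemma finite_configs: "finite V \<Longrightarrow> A \<subseteq> V \<Longrightarrow> finite (configs A)"
  unfolding configs_def by (intro finite_PiE) (auto dest: finite_subset)

lemma configs_nonempty: "configs A \<noteq> {}"
  by (simp add: configs_def PiE_eq_empty_iff)

lemma restrict_in_configs: "x \<in> configs V \<Longrightarrow> A \<subseteq> V \<Longrightarrow> restrict x A \<in> configs A"
  by (auto simp: configs_def dest: PiE_mem)

lemma configs_glue:
  assumes "a \<in> configs A" "b \<in> configs B" "A \<inter> B = {}" "A \<subseteq> V" "B \<subseteq> V"
  obtains x where "x \<in> configs V" "restrict x A = a" "restrict x B = b"
proof
  \<comment> \<open>The value 0 outside both sets is an arbitrary choice from {0, 1}.\<close>
  let ?x = "\<lambda>v\<in>V. if v \<in> A then a v else if v \<in> B then b v else 0"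
  show "?x \<in> configs V"
    using assms by (auto simp: configs_def PiE_def Pi_def)
  show "restrict ?x A = a"
    using assms by (auto simp: configs_def PiE_def Pi_def extensional_def fun_eq_iff)
  show "restrict ?x B = b"
    using assms by (auto simp: configs_def PiE_def Pi_def extensional_def fun_eq_iff)
qed

text \<open>Law of total probability. \<open>S\<close> covers the values of \<open>f\<close> on the
  support, so the fibres over \<open>S\<close> exhaust the event up to a null set.\<close>

lemma sum_prob_fibres:
  fixes p :: "'a pmf"
  assumes "finite S" "f ` set_pmf p \<subseteq> S"
  shows "(\<Sum>s\<in>S. \<P>(x in measure_pmf p. f x = s \<and> Q x)) = \<P>(x in measure_pmf p. Q x)"
proof -
  have "(\<Sum>s\<in>S. \<P>(x in measure_pmf p. f x = s \<and> Q x))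
      = measure (measure_pmf p) (\<Union>s\<in>S. {x. f x = s \<and> Q x})"
    using assms(1)
    by (subst measure_pmf.finite_measure_finite_Union) (auto simp: disjoint_family_on_def)
  also have "\<dots> = measure (measure_pmf p) {x. Q x}"
    using assms(2) by (intro measure_pmf.finite_measure_eq_AE) (auto simp: AE_measure_pmf_iff)
  finally show ?thesis by simp
qed

lemma restrict_set_pmf:
  "strictly_positive V p \<Longrightarrow> A \<subseteq> V \<Longrightarrow> (\<lambda>x. restrict x A) ` set_pmf p \<subseteq> configs A"
  by (auto simp: strictly_positive_def intro: restrict_in_configs)

lemma sum_marginal:
  assumes "finite V" "strictly_positive V p" and "A \<subseteq> V"
  shows "(\<Sum>a\<in>configs A. marginal p A a) = 1"
  using sum_prob_fibres[of "configs A" "\<lambda>x. restrict x A" p "\<lambda>_. True"]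
    finite_configs[of V A] restrict_set_pmf[of V p A] assms
  by (simp add: marginal_def)

lemma marginal_pos:
  assumes "strictly_positive V p" and "A \<subseteq> V" "a \<in> configs A"
  shows "0 < \<P>(x in measure_pmf p. restrict x A = a)"
proof -
  \<comment> \<open>Gluing with the empty configuration extends \<open>a\<close> to all of
    \<open>V\<close>.\<close>
  have "(\<lambda>_. undefined) \<in> configs {}"
    by (simp add: configs_def)
  then obtain x where "x \<in> configs V" "restrict x A = a"
    using configs_glue[OF assms(3) _ _ assms(2) empty_subsetI] by blast
  then show ?thesis
    using assms(1) by (intro measure_pmf_posI[of x]) (auto simp: strictly_positive_def)
qed

text \<open>Disjointness enters here: any \<open>a\<close> and \<open>b\<close> are compatible, so
  some configuration of positive mass restricts to both.\<close>

lemma conditional_pos: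
  assumes "strictly_positive V p" and "A \<subseteq> V" "B \<subseteq> V" "A \<inter> B = {}" "a \<in> configs A" "b \<in> configs B"
  shows "0 < conditional p A B a b"
proof -
  obtain x where "x \<in> configs V" "restrict x A = a" "restrict x B = b"
    using configs_glue[of a A b B V] assms by blast
  then have "0 < \<P>(x in measure_pmf p. restrict x A = a \<and> restrict x B = b)"
    using assms(1) by (intro measure_pmf_posI[of x]) (auto simp: strictly_positive_def)
  then show ?thesis
    using marginal_pos[of V p B b] assms by (simp add: conditional_def cond_prob_def)
qed

lemma sum_conditional:
  assumes "finite V" "strictly_positive V p" and "A \<subseteq> V" "B \<subseteq> V" "b \<in> configs B"
  shows "(\<Sum>a\<in>configs A. conditional p A B a b) = 1"
  using sum_prob_fibres[of "configs A" "\<lambda>x. restrict x A" p "\<lambda>x. restrict x B = b"]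
    finite_configs[of V A] restrict_set_pmf[of V p A]
    marginal_pos[of V p B b] assms
  by (simp add: conditional_def cond_prob_def flip: sum_divide_distrib)

text \<open>Total probability over the values of \<open>X_B\<close>; conditioning is legitimate
  because each of them has positive mass. Read as a row vector times a matrix, it is one step of the
  chain.\<close>

lemma marginal_eq_sum_conditional:
  assumes "finite V" "strictly_positive V p" and "A \<subseteq> V" "B \<subseteq> V" "a \<in> configs A"
  shows "marginal p A a = (\<Sum>b\<in>configs B. marginal p B b * conditional p A B a b)"
proof -
  have "marginal p A a
      = (\<Sum>b\<in>configs B. \<P>(x in measure_pmf p. restrict x B = b \<and> restrict x A = a))"
    using sum_prob_fibres[of "configs B" "\<lambda>x. restrict x B" p "\<lambda>x. restrict x A = a"]
      finite_configs[of V B] restrict_set_pmf[of V p B]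
      assms by (simp add: marginal_def)
  also have "\<dots> = (\<Sum>b\<in>configs B. marginal p B b * conditional p A B a b)"
    using marginal_pos[of V p B] assms
    by (intro sum.cong)
      (auto simp: marginal_def conditional_def cond_prob_def conj_commute less_imp_neq[symmetric])
  finally show ?thesis .
qed

section \<open>Going around the cycle\<close>

lemma cyc_pred_props:
  assumes "k \<ge> 2" "i \<in> {1..k}"
  shows "cyc_pred k i \<in> {1..k}" "cyc_pred k i \<noteq> i"
  using assms by (auto simp: cyc_pred_def)

lemma finite_cyc_index:
  assumes "finite V" "k \<ge> 2" "\<forall>i\<in>{1..k}. A i \<subseteq> V"
  shows "finite (cyc_index k A)"
  unfolding cyc_index_def
  using finite_configs[OF assms(1)] assms(3) cyc_pred_props(1)[OF assms(2)]
  by (intro finite_SigmaI finite_cartesian_product) auto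

text \<open>Climb from \<open>i\<close> to \<open>k\<close>, wrap around to 1, climb back to
  \<open>i\<close>. Reflexivity is the goal itself, so an empty climb, at \<open>i = k\<close> or
  \<open>i = 1\<close>, is treated separately.\<close>

lemma cyclic_closure:
  assumes "k \<ge> (2::nat)" "i \<in> {1..k}"
    and step: "\<And>i. i \<in> {1..k} \<Longrightarrow> R (cyc_pred k i) i"
    and trans: "\<And>i j l. \<lbrakk>i \<in> {1..k}; j \<in> {1..k}; l \<in> {1..k}; R i j; R j l\<rbrakk> \<Longrightarrow> R i l"
  shows "R i i"
proof -
  \<comment> \<open>The target is \<open>Suc (i + d)\<close> so that \<open>d = 0\<close> already
    stands for one genuine step.\<close>
  have up: "R i (Suc (i + d))" if "1 \<le> i" "Suc (i + d) \<le> k" for i d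
    using that
  proof (induction d)
    case 0
    then show ?case using step[of "Suc i"] by (simp add: cyc_pred_def)
  next
    case (Suc d)
    then have "R i (Suc (i + d))" "R (Suc (i + d)) (Suc (i + Suc d))"
      using step[of "Suc (i + Suc d)"] by (simp_all add: cyc_pred_def)
    then show ?case
      using Suc.prems trans[of i "Suc (i + d)" "Suc (i + Suc d)"] by simp
  qed
  have lt: "R i j" if "1 \<le> i" "i < j" "j \<le> k" for i j
    using up[of i "j - Suc i"] that by simp
  have wrap: "R k 1"
    using step[of 1] assms(1) by (simp add: cyc_pred_def)
  have "R i 1"
    using assms(1,2) lt[of i k] wrap trans[of i k 1] by (cases "i = k") auto
  then show ?thesis
    using assms(1,2) lt[of 1 i] trans[of i 1 i] by (cases "i = 1") auto
qed

lemma cyc_conditionals_pos: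
  assumes "k \<ge> 2" "\<forall>i\<in>{1..k}. A i \<subseteq> V" "disjoint_family_on A {1..k}" "strictly_positive V p"
  shows "cyc_conditionals k A p \<in> (\<Pi>\<^sub>E c\<in>cyc_index k A. {0<..})"
proof -
  have "0 < conditional p (A j) (A (cyc_pred k j)) a b"
    if j: "j \<in> {1..k}" and ab: "a \<in> configs (A j)" "b \<in> configs (A (cyc_pred k j))" for j a b
  proof -
    note pr = cyc_pred_props[OF assms(1) j]
    have "A j \<inter> A (cyc_pred k j) = {}"
      using assms(3) j pr by (auto simp: disjoint_family_on_def)
    then show ?thesis
      using conditional_pos[OF assms(4) _ _ _ ab] assms(2) j pr(1) by simp
  qed
  then show ?thesis
    by (auto simp: cyc_conditionals_def cyc_index_def)
qed

lemma kernel_between_cyc_pred: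
  assumes "finite V" "k \<ge> 2" "\<forall>i\<in>{1..k}. A i \<subseteq> V" "j \<in> {1..k}"
  shows "kernel_between (cyc_index k A) (\<Pi>\<^sub>E c\<in>cyc_index k A. {0<..})
    {p. strictly_positive V p} (cyc_conditionals k A)
    (configs (A (cyc_pred k j))) (\<lambda>p. marginal p (A (cyc_pred k j)))
    (configs (A j)) (\<lambda>p. marginal p (A j))"
proof -
  let ?j = "cyc_pred k j" and ?I = "cyc_index k A" and ?c = "cyc_conditionals k A"
  let ?U = "\<Pi>\<^sub>E c\<in>?I. {0::real<..}"
  have sub: "A j \<subseteq> V" "A ?j \<subseteq> V"
    using assms(3,4) cyc_pred_props(1)[OF assms(2,4)] by auto
  have mem: "(j, b, a) \<in> ?I" if "a \<in> configs (A ?j)" "b \<in> configs (A j)" for a b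
    using that assms(4) by (simp add: cyc_index_def)
  then have val: "?c p (j, b, a) = conditional p (A j) (A ?j) b a"
    if "a \<in> configs (A ?j)" "b \<in> configs (A j)" for p a b
    using that by (simp add: cyc_conditionals_def)
  have sm: "smooth_pos ?I ?U (\<lambda>x. x (j, b, a))"
    if "a \<in> configs (A ?j)" "b \<in> configs (A j)" for a b
    using mem[OF that] Ck_on_component by (auto simp: smooth_pos_def PiE_iff)
  show ?thesis
    unfolding kernel_between_def
  \<comment> \<open>The kernel entries are coordinates of the tuple, positive by the choice of the
    orthant. The index order is swapped: the kernel goes from \<open>a\<close> to \<open>b\<close>,
    while the array lists the conditioned value \<open>b\<close> first.\<close>
  proof (intro exI[of _ "\<lambda>a b x. x (j, b, a)"] conjI ballI)
    fix p a assume p: "p \<in> {p. strictly_positive V p}" and a: "a \<in> configs (A ?j)"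
    have "(\<Sum>b\<in>configs (A j). ?c p (j, b, a))
        = (\<Sum>b\<in>configs (A j). conditional p (A j) (A ?j) b a)"
      using a by (intro sum.cong val refl)
    then show "(\<Sum>b\<in>configs (A j). ?c p (j, b, a)) = 1"
      using sum_conditional[OF assms(1) _ sub a] p by simp
  next
    fix p b assume p: "p \<in> {p. strictly_positive V p}" and b: "b \<in> configs (A j)"
    have "(\<Sum>a\<in>configs (A ?j). marginal p (A ?j) a * ?c p (j, b, a))
        = (\<Sum>a\<in>configs (A ?j). marginal p (A ?j) a * conditional p (A j) (A ?j) b a)"
      using b by (intro sum.cong refl) (simp add: val)
    then show "marginal p (A j) b
        = (\<Sum>a\<in>configs (A ?j). marginal p (A ?j) a * ?c p (j, b, a))"
      using marginal_eq_sum_conditional[OF assms(1) _ sub b] p by simp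
  qed (rule sm)
qed

lemma kernel_between_around_cycle:
  assumes "finite V" "k \<ge> 2" "\<forall>i\<in>{1..k}. A i \<subseteq> V" "i \<in> {1..k}"
  shows "kernel_between (cyc_index k A) (\<Pi>\<^sub>E c\<in>cyc_index k A. {0<..})
    {p. strictly_positive V p} (cyc_conditionals k A)
    (configs (A i)) (\<lambda>p. marginal p (A i)) (configs (A i)) (\<lambda>p. marginal p (A i))"
proof -
  let ?R = "\<lambda>j l. kernel_between (cyc_index k A) (\<Pi>\<^sub>E c\<in>cyc_index k A. {0<..})
    {p. strictly_positive V p} (cyc_conditionals k A)
    (configs (A j)) (\<lambda>p. marginal p (A j)) (configs (A l)) (\<lambda>p. marginal p (A l))"
  show "?R i i"
  proof (rule cyclic_closure[where R = ?R, OF assms(2,4) kernel_between_cyc_pred[OF assms(1-3)]])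
    fix j l n assume l: "l \<in> {1..k}" and R: "?R j l" "?R l n"
    show "?R j n"
      using kernel_between_trans[OF R finite_configs[OF assms(1) bspec[OF assms(3) l]]
          configs_nonempty] .
  qed
qed

lemma marginal_eq_smooth_pos:
  assumes "finite V" "k \<ge> 2" "\<forall>i\<in>{1..k}. A i \<subseteq> V" "disjoint_family_on A {1..k}" "i \<in> {1..k}"
  obtains w where
    "\<forall>a\<in>configs (A i).
      smooth_pos (cyc_index k A) (\<Pi>\<^sub>E c\<in>cyc_index k A. {0<..}) (w a)"
    "\<And>p. strictly_positive V p \<Longrightarrow>
      marginal p (A i) = (\<lambda>a\<in>configs (A i). w a (cyc_conditionals k A p))"
proof -
  let ?P = "{p. strictly_positive V p}" and ?U = "\<Pi>\<^sub>E c\<in>cyc_index k A. {0::real<..}"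
  have Ai: "A i \<subseteq> V"
    using assms(3,5) by blast
  have "\<forall>p\<in>?P. cyc_conditionals k A p \<in> ?U"
    using cyc_conditionals_pos[OF assms(2-4)] by blast
  moreover have "\<forall>p\<in>?P. (\<Sum>a\<in>configs (A i). marginal p (A i) a) = 1"
    using sum_marginal[OF assms(1) _ Ai] by blast
  ultimately obtain w where w: "\<forall>a\<in>configs (A i). smooth_pos (cyc_index k A) ?U (w a)"
    and val: "\<forall>p\<in>?P. \<forall>a\<in>configs (A i). marginal p (A i) a = w a (cyc_conditionals k A p)"
    using kernel_between_self[OF kernel_between_around_cycle[OF assms(1-3,5)]
        finite_configs[OF assms(1) Ai] configs_nonempty] by blast
  show thesis
  proof (rule that[OF w])
    fix p assume "strictly_positive V p"
    then show "marginal p (A i) = (\<lambda>a\<in>configs (A i). w a (cyc_conditionals k A p))"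
      \<comment> \<open>Both sides are \<open>undefined\<close> outside
        \<open>configs (A i)\<close>, so agreement on configurations gives equality of
        functions.\<close>
      using val by (intro extensionalityI[of _ "configs (A i)"]) (auto simp: marginal_def)
  qed
qed

theorem theorem5p1:
  fixes V :: "'v set" and k :: nat and A :: "nat \<Rightarrow> 'v set"
  assumes "finite V" and "k \<ge> 2"
    and "\<forall>i\<in>{1..k}. A i \<subseteq> V"
    and "disjoint_family_on A {1..k}"
  shows "\<forall>i\<in>{1..k}.
    \<exists>(U :: (nat \<times> ('v \<Rightarrow> nat) \<times> ('v \<Rightarrow> nat) \<Rightarrow> real) set) F.
      openin (powertop_real (cyc_index k A)) U \<and>
      (\<forall>p. strictly_positive V p \<longrightarrow> cyc_conditionals k A p \<in> U) \<and>
      smooth_map_on (cyc_index k A) (configs (A i)) U F \<and>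
      (\<forall>p. strictly_positive V p \<longrightarrow> marginal p (A i) = F (cyc_conditionals k A p))"
proof
  fix i assume "i \<in> {1..k}"
  then obtain w where
    "\<forall>a\<in>configs (A i).
      smooth_pos (cyc_index k A) (\<Pi>\<^sub>E c\<in>cyc_index k A. {0<..}) (w a)"
    "\<And>p. strictly_positive V p \<Longrightarrow>
      marginal p (A i) = (\<lambda>a\<in>configs (A i). w a (cyc_conditionals k A p))"
    using marginal_eq_smooth_pos[OF assms] by metis
  then show "\<exists>(U :: (nat \<times> ('v \<Rightarrow> nat) \<times> ('v \<Rightarrow> nat) \<Rightarrow> real) set) F.
      openin (powertop_real (cyc_index k A)) U \<and>
      (\<forall>p. strictly_positive V p \<longrightarrow> cyc_conditionals k A p \<in> U) \<and>
      smooth_map_on (cyc_index k A) (configs (A i)) U F \<and>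
      (\<forall>p. strictly_positive V p \<longrightarrow> marginal p (A i) = F (cyc_conditionals k A p))"
    \<comment> \<open>The same open set, the positive orthant, serves every
      \<open>i\<close>.\<close>
    by (intro exI[of _ "\<Pi>\<^sub>E c\<in>cyc_index k A. {0<..}"]
          exI[of _ "\<lambda>x. \<lambda>a\<in>configs (A i). w a x"] conjI allI impI
          smooth_map_on_restrict cyc_conditionals_pos[OF assms(2-4)]
          openin_positive_orthant finite_cyc_index[OF assms(1-3)])
qed

end
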